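(* Let $\mathcal M$ be a von Neumann factor acting on a separable Hilbert space $H$ with a separating and cyclic unit vector $x_0$. For a linear map $\phi:\mathcal M\to\mathcal M$, the following are equivalent: (i) $\phi$ is positive; (ii) $(\omega_{x_0,x_0}\circ\tilde\phi)(A'B)\ge 0$ for every positive $A'\in\mathcal M'$ and every positive $B\in\mathcal M$.
   Context: Inner products $(\cdot|\cdot)$ are linear in the first variable. $\omega_{x,y}$ denotes the functional $A\mapsto (Ax|y)$. $\mathcal M'$ is the commutant of $\mathcal M$ and $\mathrm{alg}(\mathcal M',\mathcal M)$ is the algebra generated by $\mathcal M$ and $\mathcal M'$, i.e. the linear span of products $A'B$ with $A'\in\mathcal M'$, $B\in\mathcal M$; it is $*$-isomorphic to the algebraic tensor product $\mathcal M'\otimes\mathcal M$. For a linear map $\phi:\mathcal M\to\mathcal M$, the (well-defined) linear map $\tilde\phi$ on $\mathrm{alg}(\mathcal M',\mathcal M)$ is given by $\tilde\phi(\sum_i A_i'B_i)=\sum_i A_i'\phi(B_i)$. No continuity or boundedness of $\phi$ is assumed. *)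

theory Defs
  imports "HOL-Analysis.Analysis" "HOL-Library.Complex_Order"
begin

section \<open>Complex Hilbert spaces\<close>

class scaleC =
  fixes scaleC :: "complex \<Rightarrow> 'a \<Rightarrow> 'a"  (infixr "*\<^sub>C" 75)

class complex_vector = real_vector + scaleC +
  assumes scaleC_add_right: "a *\<^sub>C (x + y) = a *\<^sub>C x + a *\<^sub>C y"
    and scaleC_add_left: "(a + b) *\<^sub>C x = a *\<^sub>C x + b *\<^sub>C x"
    and scaleC_scaleC: "a *\<^sub>C b *\<^sub>C x = (a * b) *\<^sub>C x"
    and scaleC_one: "1 *\<^sub>C x = x"
    and scaleR_scaleC: "r *\<^sub>R x = complex_of_real r *\<^sub>C x"

text \<open>
  A complex inner product space is made a real one (as in the library class) through the real
  part of its inner product.  Positive definiteness and the formula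
  \<open>norm x = sqrt (Re (cinner x x))\<close> are then inherited from \<^class>\<open>real_inner\<close>.
\<close>
class complex_inner = complex_vector + real_inner +
  fixes cinner :: "'a \<Rightarrow> 'a \<Rightarrow> complex"
  assumes cinner_commute: "cinner x y = cnj (cinner y x)"
    and cinner_add_left: "cinner (x + y) z = cinner x z + cinner y z"
    and cinner_scaleC_left: "cinner (c *\<^sub>C x) y = c * cinner x y"
    and inner_eq_Re_cinner: "inner x y = Re (cinner x y)"

class complex_hilbert = complex_inner + complete_space

instantiation complex :: complex_hilbert
begin
definition scaleC_complex :: "complex \<Rightarrow> complex \<Rightarrow> complex"
  where "scaleC_complex c x = c * x"
definition cinner_complex :: "complex \<Rightarrow> complex \<Rightarrow> complex"
  where "cinner_complex x y = x * cnj y"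
instance
  by standard (auto simp: scaleC_complex_def cinner_complex_def inner_complex_def
      algebra_simps scaleR_conv_of_real)
end

lemma cinner_self: "cinner x x = complex_of_real ((norm x)\<^sup>2)"
proof -
  have "Im (cinner x x) = 0"
    using arg_cong[OF cinner_commute[of x x], of Im] by simp
  then show ?thesis
    by (simp add: complex_eq_iff inner_eq_Re_cinner[symmetric] power2_norm_eq_inner)
qed

lemma norm_scaleC: "norm (c *\<^sub>C x) = cmod c * norm x"
  for x :: "'a::complex_inner"
proof -
  have "cinner (c *\<^sub>C x) (c *\<^sub>C x) = c * cnj (c * cinner x x)"
    by (subst cinner_scaleC_left, subst cinner_commute, subst cinner_scaleC_left, rule refl)
  also have "\<dots> = complex_of_real ((cmod c * norm x)\<^sup>2)"
    by (simp add: cinner_self power_mult_distrib flip: complex_norm_square)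
  finally have "(norm (c *\<^sub>C x))\<^sup>2 = (cmod c * norm x)\<^sup>2"
    by (simp only: cinner_self of_real_eq_iff)
  then show ?thesis
    by (simp add: power2_eq_iff_nonneg)
qed

lemma bounded_linear_scaleC: "bounded_linear (\<lambda>x::'a::complex_inner. c *\<^sub>C x)"
  by (rule bounded_linear_intro[where K = "cmod c"])
    (simp_all add: scaleC_add_right scaleR_scaleC scaleC_scaleC norm_scaleC mult.commute)

lemmas linear_scaleC = bounded_linear.linear[OF bounded_linear_scaleC]

section \<open>Bounded operators\<close>

typedef (overloaded) 'h bop =
  "{f :: 'h::complex_hilbert \<Rightarrow> 'h. bounded_linear f \<and> (\<forall>c x. f (c *\<^sub>C x) = c *\<^sub>C f x)}"
  morphisms bop_apply Bop
  by (rule exI[of _ id]) (simp add: id_def)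

setup_lifting type_definition_bop

text \<open>Multiplication of operators is composition.  The zero space is not excluded, so
  \<open>0 \<noteq> 1\<close> cannot be part of the ring structure.\<close>
instantiation bop :: (complex_hilbert) "{complex_vector, ring, monoid_mult}"
begin

lift_definition zero_bop :: "'a bop" is "\<lambda>x. 0"
  by (simp add: linear_0[OF linear_scaleC])
lift_definition one_bop :: "'a bop" is "\<lambda>x. x"
  by simp
lift_definition plus_bop :: "'a bop \<Rightarrow> 'a bop \<Rightarrow> 'a bop" is "\<lambda>f g x. f x + g x"
  by (simp add: bounded_linear_add scaleC_add_right)
lift_definition minus_bop :: "'a bop \<Rightarrow> 'a bop \<Rightarrow> 'a bop" is "\<lambda>f g x. f x - g x"
  by (simp add: bounded_linear_sub linear_diff[OF linear_scaleC])
lift_definition uminus_bop :: "'a bop \<Rightarrow> 'a bop" is "\<lambda>f x. - f x"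
  by (simp add: bounded_linear_minus linear_neg[OF linear_scaleC])
lift_definition times_bop :: "'a bop \<Rightarrow> 'a bop \<Rightarrow> 'a bop" is "\<lambda>f g x. f (g x)"
  by (simp add: bounded_linear_compose)
lift_definition scaleC_bop :: "complex \<Rightarrow> 'a bop \<Rightarrow> 'a bop" is "\<lambda>c f x. c *\<^sub>C f x"
  by (simp add: scaleC_scaleC mult.commute bounded_linear_compose[OF bounded_linear_scaleC])
definition scaleR_bop :: "real \<Rightarrow> 'a bop \<Rightarrow> 'a bop"
  where "scaleR_bop r T = complex_of_real r *\<^sub>C T"

instance
proof
  fix a b c :: "'a bop" and z w :: complex and r s :: real
  show "a + b + c = a + (b + c)" by transfer (simp add: add.assoc)
  show "a + b = b + a" by transfer (simp add: add.commute)
  show "0 + a = a" by transfer simp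
  show "- a + a = 0" by transfer simp
  show "a - b = a + - b" by transfer simp
  show "a * b * c = a * (b * c)" by transfer simp
  show "1 * a = a" by transfer simp
  show "a * 1 = a" by transfer simp
  show "(a + b) * c = a * c + b * c" by transfer simp
  show "a * (b + c) = a * b + a * c"
    by transfer (simp add: linear_add bounded_linear.linear)
  show "z *\<^sub>C (a + b) = z *\<^sub>C a + z *\<^sub>C b"
    "r *\<^sub>R (a + b) = r *\<^sub>R a + r *\<^sub>R b"
    unfolding scaleR_bop_def by (transfer, simp add: scaleC_add_right)+
  show "(z + w) *\<^sub>C a = z *\<^sub>C a + w *\<^sub>C a"
    "(r + s) *\<^sub>R a = r *\<^sub>R a + s *\<^sub>R a"
    unfolding scaleR_bop_def by (transfer, simp add: scaleC_add_left)+
  show "z *\<^sub>C w *\<^sub>C a = (z * w) *\<^sub>C a"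
    "r *\<^sub>R s *\<^sub>R a = (r * s) *\<^sub>R a"
    unfolding scaleR_bop_def by (transfer, simp add: scaleC_scaleC)+
  show "1 *\<^sub>C a = a" "1 *\<^sub>R a = a"
    unfolding scaleR_bop_def by (transfer, simp add: scaleC_one)+
  show "r *\<^sub>R a = complex_of_real r *\<^sub>C a"
    by (simp add: scaleR_bop_def)
qed

end

definition adj :: "'h::complex_hilbert bop \<Rightarrow> 'h bop"
  where "adj T = (THE S. \<forall>x y. cinner (bop_apply T x) y = cinner x (bop_apply S y))"

definition positive_op :: "'h::complex_hilbert bop \<Rightarrow> bool"
  where "positive_op T \<longleftrightarrow> (\<forall>x. 0 \<le> cinner (bop_apply T x) x)"

definition vec_functional :: "'h::complex_hilbert \<Rightarrow> 'h \<Rightarrow> 'h bop \<Rightarrow> complex"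
  where "vec_functional x y T = cinner (bop_apply T x) y"

section \<open>Von Neumann algebras\<close>

definition commutant :: "'h::complex_hilbert bop set \<Rightarrow> 'h bop set"
  where "commutant M = {T. \<forall>S\<in>M. T * S = S * T}"

definition star_subalgebra :: "'h::complex_hilbert bop set \<Rightarrow> bool"
  where "star_subalgebra M \<longleftrightarrow>
    0 \<in> M \<and>
    (\<forall>S\<in>M. \<forall>T\<in>M. S + T \<in> M) \<and>
    (\<forall>c. \<forall>T\<in>M. c *\<^sub>C T \<in> M) \<and>
    (\<forall>S\<in>M. \<forall>T\<in>M. S * T \<in> M) \<and>
    (\<forall>T\<in>M. adj T \<in> M)"

definition von_neumann_algebra :: "'h::complex_hilbert bop set \<Rightarrow> bool"
  where "von_neumann_algebra M \<longleftrightarrow> star_subalgebra M \<and> commutant (commutant M) = M"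

definition von_neumann_factor :: "'h::complex_hilbert bop set \<Rightarrow> bool"
  where "von_neumann_factor M \<longleftrightarrow>
    von_neumann_algebra M \<and> M \<inter> commutant M = range (\<lambda>c. c *\<^sub>C 1)"

definition cyclic_vector :: "'h::complex_hilbert bop set \<Rightarrow> 'h \<Rightarrow> bool"
  where "cyclic_vector M x \<longleftrightarrow> closure ((\<lambda>T. bop_apply T x) ` M) = UNIV"

definition separating_vector :: "'h::complex_hilbert bop set \<Rightarrow> 'h \<Rightarrow> bool"
  where "separating_vector M x \<longleftrightarrow> (\<forall>T\<in>M. bop_apply T x = 0 \<longrightarrow> T = 0)"

section \<open>Linear maps on an operator algebra\<close>

text \<open>A map on \<open>M\<close> is a total function whose values outside \<open>M\<close> are irrelevant.\<close>

definition linear_self_map :: "'h::complex_hilbert bop set \<Rightarrow> ('h bop \<Rightarrow> 'h bop) \<Rightarrow> bool"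
  where "linear_self_map M \<phi> \<longleftrightarrow>
    \<phi> \<in> M \<rightarrow> M \<and>
    (\<forall>S\<in>M. \<forall>T\<in>M. \<phi> (S + T) = \<phi> S + \<phi> T) \<and>
    (\<forall>c. \<forall>T\<in>M. \<phi> (c *\<^sub>C T) = c *\<^sub>C \<phi> T)"

definition positive_map :: "'h::complex_hilbert bop set \<Rightarrow> ('h bop \<Rightarrow> 'h bop) \<Rightarrow> bool"
  where "positive_map M \<phi> \<longleftrightarrow> (\<forall>T\<in>M. positive_op T \<longrightarrow> positive_op (\<phi> T))"

text \<open>
  The map sending \<open>\<Sum>i. A\<^sub>i' B\<^sub>i\<close> to \<open>\<Sum>i. A\<^sub>i' \<phi>(B\<^sub>i)\<close>, on the algebra generated by \<open>M'\<close> and \<open>M\<close>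
  (the finite sums of products \<open>A' B\<close>).  For a factor \<open>M\<close> and a linear \<open>\<phi>\<close> the value does not
  depend on the representation chosen, which is what the definite description relies on.
  The result is unspecified outside that algebra.
\<close>
definition tilde_map ::
    "'h::complex_hilbert bop set \<Rightarrow> ('h bop \<Rightarrow> 'h bop) \<Rightarrow> 'h bop \<Rightarrow> 'h bop"
  where "tilde_map M \<phi> T = (THE S. \<exists>(n::nat) A B.
    (\<forall>i<n. A i \<in> commutant M \<and> B i \<in> M) \<and>
    T = (\<Sum>i<n. A i * B i) \<and> S = (\<Sum>i<n. A i * \<phi> (B i)))"

end

theory Submission
  imports Defs
begin

text \<open>
  Everything rests on the identity \<open>\<phi>~(A'B) = A' \<phi>(B)\<close>, which turns condition (ii) into
  \<open>(A' \<phi>(B) x\<^sub>0|x\<^sub>0) \<ge> 0\<close>.  If \<open>\<phi>\<close> is positive, then \<open>A'\<close> and \<open>\<phi>(B)\<close> are commuting positive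
  operators, so their product is positive (\<open>positive_op_mult_commuting\<close>).  Conversely, taking
  \<open>A' = T\<^sup>*T\<close> with \<open>T \<in> M'\<close> gives \<open>(\<phi>(B) T x\<^sub>0|T x\<^sub>0) \<ge> 0\<close>; the vectors \<open>T x\<^sub>0\<close> are dense, because
  a separating vector of \<open>M\<close> is cyclic for \<open>M'\<close> (\<open>separating_imp_cyclic_commutant\<close>), and so
  \<open>\<phi>(B) \<ge> 0\<close>.

  The identity itself is the place where \<open>M\<close> has to be a factor.  It says that \<open>\<phi>~\<close> is well defined:
  \<open>\<Sum>i. A\<^sub>i B\<^sub>i = 0\<close> must imply \<open>\<Sum>i. A\<^sub>i \<phi>(B\<^sub>i) = 0\<close> for an arbitrary linear \<open>\<phi>\<close>.  This is a theorem of
  Murray and von Neumann (\<open>factor_sum_products_zero\<close>): projecting a finite power of \<open>H\<close> onto a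
  closed subspace invariant under both \<open>M\<close> and \<open>M'\<close> yields a matrix with entries in the centre of
  \<open>M\<close>, that is, of scalars, and these reduce the given relation to linear relations among the
  \<open>A\<^sub>i\<close> and among the \<open>B\<^sub>i\<close>.

  Both uses of the bicommutant go through the same lemma \<open>projection_matrix\<close>; the case of a
  one-element index set is the projection in \<open>H\<close> itself.
\<close>

section \<open>Inner products and operators\<close>

lemmas bop_apply_simps [simp] =
  zero_bop.rep_eq one_bop.rep_eq plus_bop.rep_eq minus_bop.rep_eq uminus_bop.rep_eq
  times_bop.rep_eq scaleC_bop.rep_eq

lemma bop_eqI: "(\<And>x. bop_apply S x = bop_apply T x) \<Longrightarrow> S = T"
  by (simp add: bop_apply_inject[symmetric] fun_eq_iff)

lemma bounded_linear_bop_apply: "bounded_linear (bop_apply T)"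
  and bop_apply_scaleC: "bop_apply T (c *\<^sub>C x) = c *\<^sub>C bop_apply T x"
  using bop_apply[of T] by auto

lemmas linear_bop_apply = bounded_linear.linear[OF bounded_linear_bop_apply]
lemmas bop_apply_add = linear_add[OF linear_bop_apply]
  and bop_apply_diff = linear_diff[OF linear_bop_apply]
  and bop_apply_zero [simp] = linear_0[OF linear_bop_apply]
  and bop_apply_sum_right = linear_sum[OF linear_bop_apply]
  and tendsto_bop_apply = bounded_linear.tendsto[OF bounded_linear_bop_apply]

lemma bop_apply_sum: "bop_apply (\<Sum>i\<in>I. F i) x = (\<Sum>i\<in>I. bop_apply (F i) x)"
  by (induction I rule: infinite_finite_induct) auto

lemma times_scaleC_right: "S * (c *\<^sub>C T) = (c *\<^sub>C S) * T" for S T :: "'h::complex_hilbert bop"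
  by (rule bop_eqI) (simp add: bop_apply_scaleC)

lemma scaleC_minus1: "(-1) *\<^sub>C x = - (x::'a::complex_vector)"
  using scaleR_scaleC[of "-1" x] by simp

lemma scaleC_minus_left: "(- c) *\<^sub>C x = - (c *\<^sub>C (x::'a::complex_vector))"
  using scaleC_scaleC[of "-1" c x] by (simp add: scaleC_minus1)

lemma inner_scaleC_left: "inner (c *\<^sub>C x) y = inner x (cnj c *\<^sub>C y)"
  for x y :: "'a::complex_inner"
proof -
  have "cinner x (cnj c *\<^sub>C y) = c * cinner x y"
    by (subst cinner_commute, subst cinner_scaleC_left, subst (2) cinner_commute) simp
  then show ?thesis
    by (simp add: inner_eq_Re_cinner cinner_scaleC_left)
qed

text \<open>With this formula, limits and orthogonality can be treated through the real inner product.\<close>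
lemma cinner_eq_inner: "cinner x y = Complex (inner x y) (inner x (\<i> *\<^sub>C y))"
proof -
  have "inner x (\<i> *\<^sub>C y) = inner ((-\<i>) *\<^sub>C x) y"
    by (simp add: inner_scaleC_left)
  then show ?thesis
    by (simp add: inner_eq_Re_cinner cinner_scaleC_left complex_eq_iff)
qed

lemma tendsto_cinner:
  "(f \<longlongrightarrow> a) F \<Longrightarrow> (g \<longlongrightarrow> b) F \<Longrightarrow> ((\<lambda>n. cinner (f n) (g n)) \<longlongrightarrow> cinner a b) F"
  unfolding cinner_eq_inner
  by (intro tendsto_Complex tendsto_inner bounded_linear.tendsto[OF bounded_linear_scaleC, of g])

lemma cinner_add_right: "cinner x (y + z) = cinner x y + cinner x z"
  by (simp add: cinner_eq_inner scaleC_add_right inner_add_right complex_eq_iff)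

lemma cinner_scaleC_right: "cinner x (c *\<^sub>C y) = cnj c * cinner x y"
  by (subst cinner_commute, subst cinner_scaleC_left, subst (2) cinner_commute) simp

lemma cinner_eqI: "(\<And>x. cinner x y = cinner x z) \<Longrightarrow> y = z"
  using vector_eq_ldot[of y z] by (simp add: inner_eq_Re_cinner)

section \<open>Orthogonal projections in finite powers of a Hilbert space\<close>

text \<open>
  Elements of the Hilbert space \<open>H\<^sup>I\<close> are functions on the index type of which only the
  coordinates in \<open>I\<close> matter: the closure condition, applied to constant sequences, makes
  membership in \<open>K\<close> independent of the others.  Index sets instead of index types are needed
  because the length of an operator sum is not known in advance.
\<close>
definition closed_csubspace :: "'i set \<Rightarrow> ('i \<Rightarrow> 'h::complex_hilbert) set \<Rightarrow> bool"
  where "closed_csubspace I K \<longleftrightarrow>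
    (\<lambda>i. 0) \<in> K \<and>
    (\<forall>u\<in>K. \<forall>v\<in>K. (\<lambda>i. u i + v i) \<in> K) \<and>
    (\<forall>c. \<forall>v\<in>K. (\<lambda>i. c *\<^sub>C v i) \<in> K) \<and>
    (\<forall>s v. (\<forall>m. s m \<in> K) \<longrightarrow> (\<forall>i\<in>I. (\<lambda>m::nat. s m i) \<longlonglongrightarrow> v i) \<longrightarrow> v \<in> K)"

lemma
  assumes "closed_csubspace I K"
  shows closed_csubspace_zero: "(\<lambda>i. 0) \<in> K"
    and closed_csubspace_add: "u \<in> K \<Longrightarrow> v \<in> K \<Longrightarrow> (\<lambda>i. u i + v i) \<in> K"
    and closed_csubspace_scaleC: "v \<in> K \<Longrightarrow> (\<lambda>i. c *\<^sub>C v i) \<in> K"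
  using assms by (simp_all add: closed_csubspace_def)

lemma closed_csubspace_limit:
  assumes "closed_csubspace I K" "\<And>m. s m \<in> K" "\<And>i. i \<in> I \<Longrightarrow> (\<lambda>m. s m i) \<longlonglongrightarrow> v i"
  shows "v \<in> K"
proof -
  have "(\<forall>m. s m \<in> K) \<longrightarrow> (\<forall>i\<in>I. (\<lambda>m. s m i) \<longlonglongrightarrow> v i) \<longrightarrow> v \<in> K"
    using assms(1) unfolding closed_csubspace_def by (elim conjE) (erule allE, erule allE, assumption)
  then show ?thesis
    using assms(2,3) by simp
qed

lemma closed_csubspace_scaleR:
  "closed_csubspace I K \<Longrightarrow> v \<in> K \<Longrightarrow> (\<lambda>i. r *\<^sub>R v i) \<in> K"
  by (simp add: scaleR_scaleC closed_csubspace_scaleC)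

lemma closed_csubspace_diff:
  assumes "closed_csubspace I K" "u \<in> K" "v \<in> K"
  shows "(\<lambda>i. u i - v i) \<in> K"
  using closed_csubspace_add[OF assms(1,2) closed_csubspace_scaleR[OF assms(1,3), of "-1"]]
  by simp

lemma closed_csubspace_cong:
  assumes "closed_csubspace I K" "u \<in> K" "\<And>i. i \<in> I \<Longrightarrow> u i = v i"
  shows "v \<in> K"
  by (rule closed_csubspace_limit[OF assms(1), of "\<lambda>_. u"]) (use assms in auto)

text \<open>
  A sequence in \<open>K\<close> minimising the distance to \<open>v\<close> is Cauchy by the parallelogram law, and the
  difference between \<open>v\<close> and a closest point is orthogonal to \<open>K\<close>.  Real orthogonality is enough:
  it implies complex orthogonality, as \<open>K\<close> is closed under multiplication by \<open>\<i>\<close>.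
\<close>
lemma exists_orthogonal_projection:
  fixes v :: "'i \<Rightarrow> 'h::complex_hilbert"
  assumes I: "finite I" and K: "closed_csubspace I K"
  shows "\<exists>p\<in>K. \<forall>k\<in>K. (\<Sum>i\<in>I. inner (v i - p i) (k i)) = 0"
proof -
  define N where "N u = (\<Sum>i\<in>I. (norm (u i))\<^sup>2)" for u :: "'i \<Rightarrow> 'h"
  define d where "d = (INF k\<in>K. N (\<lambda>i. v i - k i))"
  have N_nonneg: "0 \<le> N u" for u
    by (simp add: N_def sum_nonneg)
  have bdd: "bdd_below ((\<lambda>k. N (\<lambda>i. v i - k i)) ` K)"
    using N_nonneg by (intro bdd_belowI[of _ 0]) auto
  have d_le: "d \<le> N (\<lambda>i. v i - k i)" if "k \<in> K" for k
    unfolding d_def using bdd that by (rule cINF_lower)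
  have "\<exists>k\<in>K. N (\<lambda>i. v i - k i) < d + 1 / Suc m" for m
  proof (rule ccontr)
    assume "\<not> ?thesis"
    then have "d + 1 / Suc m \<le> (INF k\<in>K. N (\<lambda>i. v i - k i))"
      using closed_csubspace_zero[OF K] by (intro cINF_greatest) (force simp: not_less)+
    then have "d + 1 / Suc m \<le> d"
      by (simp only: d_def)
    then show False
      by simp
  qed
  then obtain s where s: "\<And>m. s m \<in> K" "\<And>m. N (\<lambda>i. v i - s m i) < d + 1 / Suc m"
    by metis
  have close: "N (\<lambda>i. s m i - s l i) \<le> 2 * (1 / Suc m + 1 / Suc l)" for m l
  proof -
    have mid: "(\<lambda>i. (1/2) *\<^sub>R (s m i + s l i)) \<in> K"
      by (intro closed_csubspace_scaleR[OF K] closed_csubspace_add[OF K] s)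
    have par: "(norm (s m i - s l i))\<^sup>2 = 2 * (norm (v i - s m i))\<^sup>2 + 2 * (norm (v i - s l i))\<^sup>2
        - 4 * (norm (v i - (1/2) *\<^sub>R (s m i + s l i)))\<^sup>2" for i
      by (simp add: power2_norm_eq_inner algebra_simps inner_commute)
    have "N (\<lambda>i. s m i - s l i) = 2 * N (\<lambda>i. v i - s m i) + 2 * N (\<lambda>i. v i - s l i)
        - 4 * N (\<lambda>i. v i - (1/2) *\<^sub>R (s m i + s l i))"
      unfolding N_def par by (simp only: sum.distrib sum_subtractf sum_distrib_left)
    then show ?thesis
      using d_le[OF mid] s(2)[of m] s(2)[of l] by simp
  qed
  have "\<exists>z. (\<lambda>m. s m i) \<longlonglongrightarrow> z" if i: "i \<in> I" for i
  proof -
    have "Cauchy (\<lambda>m. s m i)"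
    proof (rule metric_CauchyI)
      fix e :: real assume e: "e > 0"
      obtain n :: nat where "4 / e\<^sup>2 < n"
        using reals_Archimedean2 by blast
      then have n: "4 / e\<^sup>2 < Suc n"
        by simp
      have "dist (s m i) (s l i) < e" if "m \<ge> n" "l \<ge> n" for m l
      proof -
        have "1 / Suc m \<le> 1 / Suc n" "1 / Suc l \<le> 1 / Suc n"
          using that by (simp_all add: frac_le)
        moreover have "(norm (s m i - s l i))\<^sup>2 \<le> N (\<lambda>i. s m i - s l i)"
          unfolding N_def using I i by (intro member_le_sum) auto
        ultimately have "(norm (s m i - s l i))\<^sup>2 \<le> 4 / Suc n"
          using close[of m l] by simp
        also have "\<dots> < e\<^sup>2"
          using n e by (simp add: field_simps)
        finally show ?thesis
          using e by (simp add: dist_norm power2_less_imp_less)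
      qed
      then show "\<exists>n. \<forall>m\<ge>n. \<forall>l\<ge>n. dist (s m i) (s l i) < e"
        by blast
    qed
    then show ?thesis
      using Cauchy_convergent convergent_def by blast
  qed
  then obtain p where p: "\<And>i. i \<in> I \<Longrightarrow> (\<lambda>m. s m i) \<longlonglongrightarrow> p i"
    by metis
  have pK: "p \<in> K"
    using closed_csubspace_limit[OF K s(1) p] .
  have "N (\<lambda>i. v i - p i) \<le> d"
  proof (rule LIMSEQ_le)
    show "(\<lambda>m. N (\<lambda>i. v i - s m i)) \<longlonglongrightarrow> N (\<lambda>i. v i - p i)"
      unfolding N_def by (intro tendsto_intros p)
    show "(\<lambda>m. d + 1 / Suc m) \<longlonglongrightarrow> d"
      using tendsto_add[OF tendsto_const LIMSEQ_inverse_real_of_nat, of d]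
      by (simp add: inverse_eq_divide)
  qed (use s(2) less_imp_le in blast)
  then have min: "N (\<lambda>i. v i - p i) \<le> N (\<lambda>i. v i - k i)" if "k \<in> K" for k
    using d_le[OF that] by linarith
  have "(\<Sum>i\<in>I. inner (v i - p i) (k i)) = 0" if k: "k \<in> K" for k
  proof -
    define \<rho> where "\<rho> = (\<Sum>i\<in>I. inner (v i - p i) (k i))"
    have expand: "N (\<lambda>i. v i - (p i + t *\<^sub>R k i)) = N (\<lambda>i. v i - p i) - 2 * t * \<rho> + t\<^sup>2 * N k" for t
    proof -
      have "(norm (v i - (p i + t *\<^sub>R k i)))\<^sup>2
          = (norm (v i - p i))\<^sup>2 - 2 * t * inner (v i - p i) (k i) + t\<^sup>2 * (norm (k i))\<^sup>2" for i
        unfolding power2_norm_eq_inner power2_eq_square[of t]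
        by (simp add: algebra_simps inner_commute)
      then show ?thesis
        unfolding N_def \<rho>_def by (simp add: sum.distrib sum_subtractf sum_distrib_left)
    qed
    have ineq: "0 \<le> t\<^sup>2 * N k - 2 * t * \<rho>" for t
      using min[OF closed_csubspace_add[OF K pK closed_csubspace_scaleR[OF K k, of t]]]
      unfolding expand by simp
    \<comment> \<open>The quadratic is minimal at \<open>\<rho> / N k\<close>; adding 1 to the denominator keeps the value negative
      for \<open>\<rho> \<noteq> 0\<close> and avoids a division by zero.\<close>
    have "0 \<le> (\<rho> / (1 + N k))\<^sup>2 * N k - 2 * (\<rho> / (1 + N k)) * \<rho>"
      by (rule ineq)
    also have "\<dots> = - (\<rho>\<^sup>2 * (2 + N k) / (1 + N k)\<^sup>2)"
      using N_nonneg[of k] by (simp add: divide_simps power2_eq_square) (simp add: algebra_simps)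
    finally have "\<rho>\<^sup>2 * (2 + N k) / (1 + N k)\<^sup>2 \<le> 0"
      by simp
    moreover have "0 < \<rho>\<^sup>2 * (2 + N k) / (1 + N k)\<^sup>2" if "\<rho> \<noteq> 0"
      using that N_nonneg[of k] by (intro divide_pos_pos mult_pos_pos) auto
    ultimately show ?thesis
      by (auto simp: \<rho>_def)
  qed
  then show ?thesis
    using pK by blast
qed

lemma orthogonal_projection_unique:
  fixes p q :: "'i \<Rightarrow> 'h::complex_hilbert"
  assumes I: "finite I" and K: "closed_csubspace I K"
    and p: "p \<in> K" "\<And>k. k \<in> K \<Longrightarrow> (\<Sum>i\<in>I. inner (v i - p i) (k i)) = 0"
    and q: "q \<in> K" "\<And>k. k \<in> K \<Longrightarrow> (\<Sum>i\<in>I. inner (v i - q i) (k i)) = 0"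
    and i: "i \<in> I"
  shows "p i = q i"
proof -
  have k: "(\<lambda>i. p i - q i) \<in> K"
    by (rule closed_csubspace_diff[OF K p(1) q(1)])
  have "(\<Sum>i\<in>I. inner (p i - q i) (p i - q i)) = 0"
    using p(2)[OF k] q(2)[OF k] by (simp add: inner_diff_left sum_subtractf)
  then have "inner (p i - q i) (p i - q i) = 0"
    using I i by (subst (asm) sum_nonneg_eq_0_iff) auto
  then show ?thesis
    by simp
qed

section \<open>Adjoints\<close>

text \<open>
  The functional is evaluated against a vector orthogonal to its kernel, found by projecting a
  vector outside the kernel; the space \<open>H\<close> itself is the power with index set \<open>{()}\<close>.
\<close>
lemma Riesz_representation:
  fixes f :: "'h::complex_hilbert \<Rightarrow> complex"
  assumes f: "bounded_linear f" and f_scaleC: "\<And>c x. f (c *\<^sub>C x) = c * f x"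
  shows "\<exists>y. \<forall>x. f x = cinner x y"
proof (cases "\<forall>x. f x = 0")
  case True
  have "cinner x 0 = 0" for x :: 'h
    using cinner_add_right[of x 0 0] by simp
  with True show ?thesis
    by metis
next
  case False
  then obtain v where v: "f v \<noteq> 0"
    by blast
  interpret f: bounded_linear f by (rule f)
  define K where "K = {k :: unit \<Rightarrow> 'h. f (k ()) = 0}"
  have "closed_csubspace {()} K"
    unfolding closed_csubspace_def K_def
  proof (intro conjI ballI allI impI, simp_all add: f.add f.zero f_scaleC)
    fix s :: "nat \<Rightarrow> unit \<Rightarrow> 'h" and w
    assume "\<forall>m. f (s m ()) = 0" "(\<lambda>m. s m ()) \<longlonglongrightarrow> w ()"
    then show "f (w ()) = 0"
      using f.tendsto[of "\<lambda>m. s m ()" "w ()" sequentially] by (simp add: LIMSEQ_const_iff)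
  qed
  from exists_orthogonal_projection[OF _ this, of "\<lambda>_. v"] obtain p
    where p: "p \<in> K" "\<And>k. k \<in> K \<Longrightarrow> inner (v - p ()) (k ()) = 0"
    by auto
  define u where "u = v - p ()"
  have fu: "f u = f v"
    using p(1) by (simp add: u_def K_def f.diff)
  then have u0: "norm u \<noteq> 0"
    using v f.zero by auto
  have orth: "cinner x u = 0" if "f x = 0" for x
  proof -
    have "inner u (c *\<^sub>C x) = 0" for c
      using p(2)[of "\<lambda>_. c *\<^sub>C x"] that by (simp add: K_def f_scaleC u_def)
    from this[of 1] this[of \<i>] have "cinner u x = 0"
      by (simp add: cinner_eq_inner scaleC_one complex_eq_iff)
    then show ?thesis
      by (subst cinner_commute) simp
  qed
  have "f x = cinner x ((cnj (f u) / of_real ((norm u)\<^sup>2)) *\<^sub>C u)" for x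
  proof -
    have "f (x + (- (f x / f u)) *\<^sub>C u) = 0"
      using v fu by (simp add: f.add f_scaleC del: minus_divide_left)
    from orth[OF this] have "cinner x u = f x / f u * of_real ((norm u)\<^sup>2)"
      by (simp add: cinner_add_left cinner_scaleC_left cinner_self del: minus_divide_left)
    then show ?thesis
      using v fu u0 by (simp add: cinner_scaleC_right)
  qed
  then show ?thesis
    by blast
qed

text \<open>
  Riesz representation gives, for each \<open>y\<close>, the value \<open>s y\<close> of the operator that the definite
  description in the definition of the adjoint refers to.
\<close>
lemma adj_cinner: "cinner (bop_apply T x) y = cinner x (bop_apply (adj T) y)"
proof -
  have "\<exists>s. \<forall>x. cinner (bop_apply T x) y = cinner x s" for y
  proof (rule Riesz_representation)
    show "bounded_linear (\<lambda>x. cinner (bop_apply T x) y)"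
    proof
      fix r :: real and a b
      show "cinner (bop_apply T (a + b)) y = cinner (bop_apply T a) y + cinner (bop_apply T b) y"
        by (simp add: bop_apply_add cinner_add_left)
      show "cinner (bop_apply T (r *\<^sub>R a)) y = r *\<^sub>R cinner (bop_apply T a) y"
        by (simp add: scaleR_scaleC[of r a] bop_apply_scaleC cinner_scaleC_left scaleR_conv_of_real)
    next
      obtain B where B: "\<And>x. norm (bop_apply T x) \<le> norm x * B"
        using bounded_linear.bounded[OF bounded_linear_bop_apply] by blast
      have "cmod (cinner a y) \<le> norm a * (norm y + norm (\<i> *\<^sub>C y))" for a
        using cmod_le[of "cinner a y"] Cauchy_Schwarz_ineq2[of a y]
          Cauchy_Schwarz_ineq2[of a "\<i> *\<^sub>C y"]
        by (simp add: cinner_eq_inner algebra_simps)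
      then have "cmod (cinner (bop_apply T x) y) \<le> norm x * (B * (norm y + norm (\<i> *\<^sub>C y)))" for x
        using mult_right_mono[OF B[of x], of "norm y + norm (\<i> *\<^sub>C y)"]
        by (smt (verit) mult.assoc norm_ge_zero)
      then show "\<exists>C. \<forall>x. norm (cinner (bop_apply T x) y) \<le> norm x * C"
        by blast
    qed
  qed (simp add: bop_apply_scaleC cinner_scaleC_left)
  then obtain s where s: "\<And>x y. cinner (bop_apply T x) y = cinner x (s y)"
    by metis
  have "bounded_linear s"
  proof
    fix r :: real and a b
    show "s (a + b) = s a + s b"
      by (rule cinner_eqI) (simp add: cinner_add_right flip: s)
    show "s (r *\<^sub>R a) = r *\<^sub>R s a"
      by (rule cinner_eqI) (simp add: scaleR_scaleC cinner_scaleC_right flip: s)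
  next
    obtain B where B: "\<And>x. norm (bop_apply T x) \<le> norm x * B"
      using bounded_linear.bounded[OF bounded_linear_bop_apply] by blast
    have "norm (s y) \<le> norm y * B" for y
    proof (cases "s y = 0")
      case False
      have "norm (s y) * norm (s y) = inner (bop_apply T (s y)) y"
        by (simp add: inner_eq_Re_cinner s cinner_self power2_eq_square)
      also have "\<dots> \<le> norm (bop_apply T (s y)) * norm y"
        by (rule norm_cauchy_schwarz)
      also have "\<dots> \<le> norm (s y) * B * norm y"
        by (intro mult_right_mono B) simp
      finally show ?thesis
        using False by (simp add: mult.assoc mult.commute)
    next
      case True
      then show ?thesis
        using order_trans[OF norm_ge_zero B[of y]] by simp
    qed
    then show "\<exists>B. \<forall>y. norm (s y) \<le> norm y * B"
      by blast
  qed
  moreover have "s (c *\<^sub>C y) = c *\<^sub>C s y" for c y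
    by (rule cinner_eqI) (simp add: cinner_scaleC_right flip: s)
  ultimately have S: "\<forall>x y. cinner (bop_apply T x) y = cinner x (bop_apply (Bop s) y)"
    by (simp add: s Bop_inverse)
  have "\<forall>x y. cinner (bop_apply T x) y = cinner x (bop_apply (adj T) y)"
    unfolding adj_def
  proof (rule theI[where a = "Bop s"], rule S)
    fix R assume "\<forall>x y. cinner (bop_apply T x) y = cinner x (bop_apply R y)"
    with S have "cinner x (bop_apply R y) = cinner x (bop_apply (Bop s) y)" for x y
      by simp
    then show "R = Bop s"
      by (rule bop_eqI[OF cinner_eqI])
  qed
  then show ?thesis
    by blast
qed

lemma adj_inner: "inner (bop_apply T x) y = inner x (bop_apply (adj T) y)"
  by (simp add: inner_eq_Re_cinner adj_cinner)

lemma adj_adj: "adj (adj T) = T"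
proof (rule bop_eqI, rule cinner_eqI)
  fix x y
  have "cinner x (bop_apply (adj (adj T)) y) = cinner (bop_apply (adj T) x) y"
    by (rule adj_cinner[symmetric])
  also have "\<dots> = cnj (cinner y (bop_apply (adj T) x))"
    by (rule cinner_commute)
  also have "\<dots> = cnj (cinner (bop_apply T y) x)"
    by (simp only: adj_cinner)
  also have "\<dots> = cinner x (bop_apply T y)"
    by (rule cinner_commute[symmetric])
  finally show "cinner x (bop_apply (adj (adj T)) y) = cinner x (bop_apply T y)" .
qed

lemma adj_times: "adj (S * T) = adj T * adj S"
  by (rule bop_eqI, rule cinner_eqI) (simp flip: adj_cinner)

section \<open>Projections as operator matrices\<close>

text \<open>
  The orthogonal projection onto an invariant subspace of \<open>H\<^sup>I\<close> commutes with the diagonal action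
  of the operators, so that the entries of its matrix lie in their commutant.  This is how an
  algebraic hypothesis on \<open>M\<close> acquires consequences for subspaces.
\<close>
lemma projection_matrix:
  fixes K :: "('i \<Rightarrow> 'h::complex_hilbert) set"
  assumes I: "finite I" and K: "closed_csubspace I K"
  obtains P :: "'i \<Rightarrow> 'i \<Rightarrow> 'h bop"
  where "\<And>v. (\<lambda>i. \<Sum>j\<in>I. bop_apply (P i j) (v j)) \<in> K"
    and "\<And>v i. v \<in> K \<Longrightarrow> i \<in> I \<Longrightarrow> (\<Sum>j\<in>I. bop_apply (P i j) (v j)) = v i"
    and "\<And>X i j. (\<And>k. k \<in> K \<Longrightarrow> (\<lambda>i. bop_apply X (k i)) \<in> K) \<Longrightarrow>
      (\<And>k. k \<in> K \<Longrightarrow> (\<lambda>i. bop_apply (adj X) (k i)) \<in> K) \<Longrightarrow>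
      i \<in> I \<Longrightarrow> j \<in> I \<Longrightarrow> X * P i j = P i j * X"
proof -
  obtain p where pK: "\<And>v. p v \<in> K"
    and p_orth: "\<And>v k. k \<in> K \<Longrightarrow> (\<Sum>i\<in>I. inner (v i - p v i) (k i)) = 0"
    using exists_orthogonal_projection[OF I K] by metis
  have p_eqI: "p v i = q i"
    if "q \<in> K" "\<And>k. k \<in> K \<Longrightarrow> (\<Sum>i\<in>I. inner (v i - q i) (k i)) = 0" "i \<in> I" for v q i
    using orthogonal_projection_unique[OF I K pK p_orth that] .
  have p_add: "p (\<lambda>i. u i + v i) i = p u i + p v i" if "i \<in> I" for u v i
  proof (rule p_eqI[OF closed_csubspace_add[OF K pK pK] _ that])
    fix k assume "k \<in> K"
    from p_orth[OF this, of u] p_orth[OF this, of v]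
    show "(\<Sum>i\<in>I. inner (u i + v i - (p u i + p v i)) (k i)) = 0"
      by (simp add: inner_diff_left inner_add_left sum.distrib sum_subtractf)
  qed
  have p_scaleC: "p (\<lambda>i. c *\<^sub>C v i) i = c *\<^sub>C p v i" if "i \<in> I" for c v i
  proof (rule p_eqI[OF closed_csubspace_scaleC[OF K pK] _ that])
    fix k assume "k \<in> K"
    from p_orth[OF closed_csubspace_scaleC[OF K this], of v "cnj c"]
    show "(\<Sum>i\<in>I. inner (c *\<^sub>C v i - c *\<^sub>C p v i) (k i)) = 0"
      by (simp add: inner_scaleC_left flip: linear_diff[OF linear_scaleC])
  qed
  have p_norm: "norm (p v i) ^ 2 \<le> (\<Sum>i\<in>I. norm (v i) ^ 2)" if "i \<in> I" for v i
  proof -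
    have "norm (p v i) ^ 2 \<le> (\<Sum>i\<in>I. norm (p v i) ^ 2)"
      using I that by (intro member_le_sum) auto
    also have "\<dots> \<le> (\<Sum>i\<in>I. norm (p v i) ^ 2 + norm (v i - p v i) ^ 2)"
      by (intro sum_mono) simp
    also have "\<dots> = (\<Sum>i\<in>I. norm (v i) ^ 2 - 2 * inner (v i - p v i) (p v i))"
      by (intro sum.cong) (simp_all add: power2_norm_eq_inner algebra_simps inner_commute)
    also have "\<dots> = (\<Sum>i\<in>I. norm (v i) ^ 2)"
      using p_orth[OF pK, of v v] by (simp add: sum_subtractf flip: sum_distrib_left)
    finally show ?thesis .
  qed
  define e where "e j z = (\<lambda>i. if i = j then z else 0)" for j :: 'i and z :: 'h
  define P where "P i j = Bop (\<lambda>z. p (e j z) i)" for i j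
  have P: "bop_apply (P i j) z = p (e j z) i" if i: "i \<in> I" and j: "j \<in> I" for i j z
  proof -
    have add: "p (e j (a + b)) i = p (e j a) i + p (e j b) i" for a b
    proof -
      have "e j (a + b) = (\<lambda>i. e j a i + e j b i)"
        by (auto simp: e_def)
      then show ?thesis
        using p_add[OF i] by metis
    qed
    have scaleC: "p (e j (c *\<^sub>C a)) i = c *\<^sub>C p (e j a) i" for c a
    proof -
      have "e j (c *\<^sub>C a) = (\<lambda>i. c *\<^sub>C e j a i)"
        by (auto simp: e_def linear_0[OF linear_scaleC])
      then show ?thesis
        using p_scaleC[OF i] by metis
    qed
    have "norm (p (e j a) i) ^ 2 \<le> norm a ^ 2" for a
    proof -
      have "norm (e j a l) ^ 2 = (if l = j then norm a ^ 2 else 0)" for l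
        by (simp add: e_def)
      then show ?thesis
        using p_norm[OF i, of "e j a"] I j by simp
    qed
    then have "norm (p (e j a) i) \<le> norm a * 1" for a
      by (simp add: power2_le_iff_abs_le)
    then have "bounded_linear (\<lambda>z. p (e j z) i)"
      by (intro bounded_linear_intro[where K = 1]) (auto simp: add scaleC scaleR_scaleC)
    then show ?thesis
      by (simp add: P_def Bop_inverse scaleC)
  qed
  have p_cong: "p u i = p v i" if "\<And>l. l \<in> I \<Longrightarrow> u l = v l" "i \<in> I" for u v i
  proof (rule p_eqI[OF pK _ that(2)])
    fix k assume "k \<in> K"
    from p_orth[OF this, of v] that(1) show "(\<Sum>i\<in>I. inner (u i - p v i) (k i)) = 0"
      by (simp cong: sum.cong)
  qed
  have P_sum: "(\<Sum>j\<in>I. bop_apply (P i j) (v j)) = p v i" if i: "i \<in> I" for v i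
  proof -
    have "(\<Sum>j\<in>J. p (e j (v j)) i) = p (\<lambda>l. \<Sum>j\<in>J. e j (v j) l) i" if "finite J" for J
      using that
    proof induction
      case empty
      show ?case
        using p_add[OF i, of "\<lambda>_. 0" "\<lambda>_. 0"] by simp
    qed (simp add: p_add[OF i])
    then have "(\<Sum>j\<in>I. p (e j (v j)) i) = p (\<lambda>l. \<Sum>j\<in>I. e j (v j) l) i"
      using I by blast
    also have "\<dots> = p v i"
      by (rule p_cong[OF _ i]) (simp add: e_def I)
    finally show ?thesis
      using i by (simp add: P)
  qed
  show ?thesis
  proof
    show "(\<lambda>i. \<Sum>j\<in>I. bop_apply (P i j) (v j)) \<in> K" for v
      by (rule closed_csubspace_cong[OF K pK[of v]]) (simp add: P_sum)
    show "(\<Sum>j\<in>I. bop_apply (P i j) (v j)) = v i" if "v \<in> K" "i \<in> I" for v i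
      using p_eqI[of v v i] that by (simp add: P_sum)
    show "X * P i j = P i j * X"
      if X: "\<And>k. k \<in> K \<Longrightarrow> (\<lambda>i. bop_apply X (k i)) \<in> K"
        and X': "\<And>k. k \<in> K \<Longrightarrow> (\<lambda>i. bop_apply (adj X) (k i)) \<in> K"
        and i: "i \<in> I" and j: "j \<in> I" for X i j
    proof (rule bop_eqI)
      fix z
      have "p (\<lambda>l. bop_apply X (e j z l)) i = bop_apply X (p (e j z) i)"
      proof (rule p_eqI[OF X[OF pK] _ i])
        fix k assume "k \<in> K"
        from p_orth[OF X'[OF this], of "e j z"]
        show "(\<Sum>i\<in>I. inner (bop_apply X (e j z i) - bop_apply X (p (e j z) i)) (k i)) = 0"
          by (simp add: adj_inner flip: bop_apply_diff)
      qed
      moreover have "(\<lambda>l. bop_apply X (e j z l)) = e j (bop_apply X z)"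
        by (auto simp: e_def)
      ultimately show "bop_apply (X * P i j) z = bop_apply (P i j * X) z"
        using i j by (simp add: P)
    qed
  qed
qed

section \<open>Von Neumann algebras and their commutants\<close>

lemma commutantD: "T \<in> commutant M \<Longrightarrow> S \<in> M \<Longrightarrow> T * S = S * T"
  by (simp add: commutant_def)

lemma commutant_apply_commute:
  "T \<in> commutant M \<Longrightarrow> S \<in> M \<Longrightarrow> bop_apply T (bop_apply S x) = bop_apply S (bop_apply T x)"
  using commutantD[of T M S] by (metis times_bop.rep_eq)

lemma star_subalgebra_commutant:
  fixes M :: "'h::complex_hilbert bop set"
  assumes "\<And>T. T \<in> M \<Longrightarrow> adj T \<in> M"
  shows "star_subalgebra (commutant M)"
  unfolding star_subalgebra_def
proof (intro conjI ballI allI)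
  fix S T :: "'h bop" and c
  assume S: "S \<in> commutant M"
  show "adj S \<in> commutant M"
    unfolding commutant_def mem_Collect_eq
  proof
    fix R assume "R \<in> M"
    then have "adj R * S = S * adj R"
      using assms S commutantD by metis
    from arg_cong[OF this, of adj] show "adj S * R = R * adj S"
      by (simp add: adj_times adj_adj)
  qed
  show "c *\<^sub>C S \<in> commutant M"
    using commutant_apply_commute[OF S]
    by (auto simp: commutant_def bop_apply_scaleC intro!: bop_eqI)
  assume T: "T \<in> commutant M"
  show "S + T \<in> commutant M"
    using S T by (auto simp: commutant_def algebra_simps)
  show "S * T \<in> commutant M"
    using S T unfolding commutant_def by (auto simp: mult.assoc) (metis mult.assoc)
qed (auto simp: commutant_def)

lemma one_in_commutant: "1 \<in> commutant M"
  by (simp add: commutant_def)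

text \<open>
  The projection onto the closure of \<open>M' x\<close> lies in \<open>M'' = M\<close> and fixes \<open>x\<close>, so it agrees with the
  identity on a separating vector.
\<close>
lemma separating_imp_cyclic_commutant:
  fixes M :: "'h::complex_hilbert bop set"
  assumes M: "von_neumann_algebra M" and x: "separating_vector M x"
  shows "cyclic_vector (commutant M) x"
proof -
  let ?M' = "commutant M"
  let ?L = "closure ((\<lambda>T. bop_apply T x) ` ?M')"
  have star: "star_subalgebra ?M'"
    using M by (intro star_subalgebra_commutant)
      (simp add: von_neumann_algebra_def star_subalgebra_def)
  have invariant: "g a \<in> ?L" if "bounded_linear g" "a \<in> ?L"
    "\<And>T. T \<in> ?M' \<Longrightarrow> \<exists>S\<in>?M'. g (bop_apply T x) = bop_apply S x" for g a
  proof -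
    have "g ` ((\<lambda>T. bop_apply T x) ` ?M') \<subseteq> (\<lambda>T. bop_apply T x) ` ?M'"
      using that(3) by auto
    then show ?thesis
      using closure_bounded_linear_image_subset[OF that(1)] closure_mono that(2) by blast
  qed
  have L_scaleC: "c *\<^sub>C a \<in> ?L" if "a \<in> ?L" for c a
    by (rule invariant[OF bounded_linear_scaleC that])
      (use star in \<open>auto simp: star_subalgebra_def intro!: bexI[of _ "c *\<^sub>C _"]\<close>)
  have L_apply: "bop_apply T a \<in> ?L" if "a \<in> ?L" "T \<in> ?M'" for T a
  proof (rule invariant[OF bounded_linear_bop_apply that(1)])
    fix S assume "S \<in> ?M'"
    then have "T * S \<in> ?M'"
      using that(2) star by (simp add: star_subalgebra_def)
    then show "\<exists>R\<in>?M'. bop_apply T (bop_apply S x) = bop_apply R x"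
      by (intro bexI[of _ "T * S"]) simp
  qed
  have L_add: "a + b \<in> ?L" if a: "a \<in> ?L" and b: "b \<in> ?L" for a b
  proof -
    have sum: "u + v \<in> (\<lambda>T. bop_apply T x) ` ?M'"
      if uv: "u \<in> (\<lambda>T. bop_apply T x) ` ?M'" "v \<in> (\<lambda>T. bop_apply T x) ` ?M'" for u v
    proof -
      obtain S T where ST: "S \<in> ?M'" "T \<in> ?M'" "u = bop_apply S x" "v = bop_apply T x"
        using uv by blast
      then have "S + T \<in> ?M'"
        using star by (simp add: star_subalgebra_def)
      then show ?thesis
        using ST by (intro image_eqI[of _ _ "S + T"]) simp_all
    qed
    obtain s t where s: "\<And>n. s n \<in> (\<lambda>T. bop_apply T x) ` ?M'" "s \<longlonglongrightarrow> a"
      and t: "\<And>n. t n \<in> (\<lambda>T. bop_apply T x) ` ?M'" "t \<longlonglongrightarrow> b"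
      using a b unfolding closure_sequential by blast
    have "(\<lambda>n. s n + t n) \<longlonglongrightarrow> a + b"
      by (rule tendsto_add[OF s(2) t(2)])
    moreover have "s n + t n \<in> (\<lambda>T. bop_apply T x) ` ?M'" for n
      by (rule sum[OF s(1) t(1)])
    ultimately show ?thesis
      unfolding closure_sequential by (intro exI[of _ "\<lambda>n. s n + t n"]) blast
  qed
  have L_zero: "0 \<in> ?L"
    by (rule subsetD[OF closure_subset])
      (use star in \<open>auto simp: star_subalgebra_def image_iff intro!: bexI[of _ 0]\<close>)
  have x_L: "x \<in> ?L"
    by (rule subsetD[OF closure_subset]) (auto simp: image_iff one_in_commutant intro!: bexI[of _ 1])
  define K where "K = {k :: unit \<Rightarrow> 'h. k () \<in> ?L}"
  have "closed_csubspace {()} K"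
    unfolding closed_csubspace_def K_def
    using L_scaleC L_add L_zero
    by (auto intro: closed_sequentially[OF closed_closure, where f = "\<lambda>m. _ m ()"])
  from projection_matrix[OF _ this] obtain P where P:
    "\<And>v :: unit \<Rightarrow> 'h. (\<lambda>i. bop_apply (P i ()) (v ())) \<in> K"
    "\<And>v. v \<in> K \<Longrightarrow> bop_apply (P () ()) (v ()) = v ()"
    "\<And>X. (\<And>k. k \<in> K \<Longrightarrow> (\<lambda>i. bop_apply X (k i)) \<in> K) \<Longrightarrow>
      (\<And>k. k \<in> K \<Longrightarrow> (\<lambda>i. bop_apply (adj X) (k i)) \<in> K) \<Longrightarrow> X * P () () = P () () * X"
    by auto
  define E where "E = P () ()"
  have "T * E = E * T" if "T \<in> ?M'" for T
    unfolding E_def using that star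
    by (intro P(3)) (auto simp: K_def star_subalgebra_def intro: L_apply)
  then have "E \<in> M" "1 \<in> M"
    using M one_in_commutant by (auto simp: von_neumann_algebra_def commutant_def)
  then have "E + (-1) *\<^sub>C 1 \<in> M"
    using M by (simp add: von_neumann_algebra_def star_subalgebra_def)
  moreover have "bop_apply E x = x"
    using P(2)[of "\<lambda>_. x"] x_L by (simp add: E_def K_def)
  ultimately have "E = 1"
    using x by (auto simp: separating_vector_def scaleC_minus1)
  then have "y \<in> ?L" for y
    using P(1)[of "\<lambda>_. y"] by (simp add: K_def E_def)
  then show ?thesis
    unfolding cyclic_vector_def by blast
qed

section \<open>Well-definedness of the extended map\<close>

lemma linear_self_map_sum:
  assumes \<phi>: "linear_self_map M \<phi>" and M: "star_subalgebra M"
    and "finite J" "\<And>j. j \<in> J \<Longrightarrow> B j \<in> M"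
  shows "(\<Sum>j\<in>J. c j *\<^sub>C B j) \<in> M \<and> \<phi> (\<Sum>j\<in>J. c j *\<^sub>C B j) = (\<Sum>j\<in>J. c j *\<^sub>C \<phi> (B j))"
  using assms(3,4)
proof induction
  case empty
  have "\<phi> (0 *\<^sub>C 0) = 0 *\<^sub>C \<phi> 0" "0 \<in> M"
    using \<phi> M by (simp_all add: linear_self_map_def star_subalgebra_def)
  moreover have "0 *\<^sub>C x = 0" for x :: "'a bop"
    using scaleR_scaleC[of 0 x] by simp
  ultimately show ?case
    by simp
next
  case (insert j J)
  then show ?case
    using \<phi> M by (simp add: linear_self_map_def star_subalgebra_def)
qed

text \<open>
  The vectors \<open>v\<close> of \<open>H\<^sup>I\<close> with \<open>\<Sum>i. A\<^sub>i T v\<^sub>i = 0\<close> for all \<open>T\<close> in \<open>M'\<close> form a closed subspace that is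
  invariant under \<open>M\<close> and \<open>M'\<close>.  The matrix entries of the projection onto it lie in
  \<open>M \<inter> M'\<close>, hence are scalars \<open>c\<^sub>i\<^sub>j\<close>.  As the subspace contains all \<open>(B\<^sub>i z)\<^sub>i\<close> and is annihilated
  by \<open>(A\<^sub>i)\<^sub>i\<close>, we get \<open>B\<^sub>i = \<Sum>j. c\<^sub>i\<^sub>j B\<^sub>j\<close> and \<open>\<Sum>i. c\<^sub>i\<^sub>j A\<^sub>i = 0\<close>: the relation
  \<open>\<Sum>i. A\<^sub>i B\<^sub>i = 0\<close> follows from linear relations, which \<open>\<phi>\<close> preserves.
\<close>
lemma factor_sum_products_zero:
  fixes M :: "'h::complex_hilbert bop set"
  assumes M: "von_neumann_factor M" and \<phi>: "linear_self_map M \<phi>" and I: "finite I"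
    and A: "\<And>i. i \<in> I \<Longrightarrow> A i \<in> commutant M" and B: "\<And>i. i \<in> I \<Longrightarrow> B i \<in> M"
    and zero: "(\<Sum>i\<in>I. A i * B i) = 0"
  shows "(\<Sum>i\<in>I. A i * \<phi> (B i)) = 0"
proof -
  let ?M' = "commutant M"
  have star: "star_subalgebra M" and bicomm: "commutant ?M' = M"
    and center: "M \<inter> ?M' = range (\<lambda>c. c *\<^sub>C 1)"
    using M by (auto simp: von_neumann_factor_def von_neumann_algebra_def)
  have star': "star_subalgebra ?M'"
    using star by (intro star_subalgebra_commutant) (simp add: star_subalgebra_def)
  define K where "K = {v. \<forall>T\<in>?M'. (\<Sum>i\<in>I. bop_apply (A i) (bop_apply T (v i))) = 0}"
  have K: "closed_csubspace I K"
    unfolding closed_csubspace_def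
  proof (intro conjI ballI allI impI)
    show "(\<lambda>i. 0) \<in> K"
      by (simp add: K_def)
    show "(\<lambda>i. u i + v i) \<in> K" if "u \<in> K" "v \<in> K" for u v
      using that by (simp add: K_def bop_apply_add sum.distrib)
    show "(\<lambda>i. c *\<^sub>C v i) \<in> K" if "v \<in> K" for c v
      using that by (simp add: K_def bop_apply_scaleC linear_0[OF linear_scaleC]
          flip: linear_sum[OF linear_scaleC])
    show "v \<in> K" if s: "\<forall>m. s m \<in> K" "\<forall>i\<in>I. (\<lambda>m::nat. s m i) \<longlonglongrightarrow> v i" for s v
      unfolding K_def mem_Collect_eq
    proof
      fix T assume T: "T \<in> ?M'"
      have "(\<lambda>m. \<Sum>i\<in>I. bop_apply (A i) (bop_apply T (s m i)))
          \<longlonglongrightarrow> (\<Sum>i\<in>I. bop_apply (A i) (bop_apply T (v i)))"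
        using s(2) by (intro tendsto_sum tendsto_bop_apply) blast
      moreover have "(\<lambda>m. \<Sum>i\<in>I. bop_apply (A i) (bop_apply T (s m i))) = (\<lambda>m. 0)"
        using s(1) T by (simp add: K_def)
      ultimately show "(\<Sum>i\<in>I. bop_apply (A i) (bop_apply T (v i))) = 0"
        by (simp add: LIMSEQ_const_iff)
    qed
  qed
  have K_M: "(\<lambda>i. bop_apply X (k i)) \<in> K" if X: "X \<in> M" and k: "k \<in> K" for X k
    unfolding K_def mem_Collect_eq
  proof
    fix T assume T: "T \<in> ?M'"
    have "(\<Sum>i\<in>I. bop_apply (A i) (bop_apply T (bop_apply X (k i))))
        = bop_apply X (\<Sum>i\<in>I. bop_apply (A i) (bop_apply T (k i)))"
      by (simp add: bop_apply_sum_right commutant_apply_commute[OF T X]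
          commutant_apply_commute[OF A X])
    then show "(\<Sum>i\<in>I. bop_apply (A i) (bop_apply T (bop_apply X (k i)))) = 0"
      using k T by (simp add: K_def)
  qed
  have K_M': "(\<lambda>i. bop_apply X (k i)) \<in> K" if X: "X \<in> ?M'" and k: "k \<in> K" for X k
    unfolding K_def mem_Collect_eq
  proof
    fix T assume "T \<in> ?M'"
    then have "T * X \<in> ?M'"
      using X star' by (simp add: star_subalgebra_def)
    then show "(\<Sum>i\<in>I. bop_apply (A i) (bop_apply T (bop_apply X (k i)))) = 0"
      using k by (auto simp: K_def)
  qed
  obtain P where P_K: "\<And>v. (\<lambda>i. \<Sum>j\<in>I. bop_apply (P i j) (v j)) \<in> K"
    and P_id: "\<And>v i. v \<in> K \<Longrightarrow> i \<in> I \<Longrightarrow> (\<Sum>j\<in>I. bop_apply (P i j) (v j)) = v i"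
    and P_commute: "\<And>X i j. (\<And>k. k \<in> K \<Longrightarrow> (\<lambda>i. bop_apply X (k i)) \<in> K) \<Longrightarrow>
      (\<And>k. k \<in> K \<Longrightarrow> (\<lambda>i. bop_apply (adj X) (k i)) \<in> K) \<Longrightarrow>
      i \<in> I \<Longrightarrow> j \<in> I \<Longrightarrow> X * P i j = P i j * X"
    using projection_matrix[OF I K] by blast
  have "\<exists>c. P i j = c *\<^sub>C 1" if "i \<in> I" "j \<in> I" for i j
  proof -
    have "X * P i j = P i j * X" if "X \<in> M \<union> ?M'" for X
      using that star star' \<open>i \<in> I\<close> \<open>j \<in> I\<close> K_M K_M'
      by (intro P_commute) (auto simp: star_subalgebra_def)
    then have "P i j \<in> commutant ?M' \<inter> ?M'"
      by (auto simp: commutant_def)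
    then show ?thesis
      using bicomm center by auto
  qed
  then obtain c where c: "\<And>i j. i \<in> I \<Longrightarrow> j \<in> I \<Longrightarrow> P i j = c i j *\<^sub>C 1"
    by metis
  have B_relation: "B i = (\<Sum>j\<in>I. c i j *\<^sub>C B j)" if i: "i \<in> I" for i
  proof (rule bop_eqI)
    fix z
    have "(\<lambda>l. bop_apply (B l) z) \<in> K"
      unfolding K_def mem_Collect_eq
    proof
      fix T assume T: "T \<in> ?M'"
      have "(\<Sum>l\<in>I. bop_apply (A l) (bop_apply T (bop_apply (B l) z)))
          = bop_apply (\<Sum>l\<in>I. A l * B l) (bop_apply T z)"
        by (simp add: bop_apply_sum commutant_apply_commute[OF T B])
      then show "(\<Sum>l\<in>I. bop_apply (A l) (bop_apply T (bop_apply (B l) z))) = 0"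
        by (simp add: zero)
    qed
    from P_id[OF this i] show "bop_apply (B i) z = bop_apply (\<Sum>j\<in>I. c i j *\<^sub>C B j) z"
      using i by (simp add: bop_apply_sum c cong: sum.cong)
  qed
  have A_relation: "(\<Sum>i\<in>I. c i j *\<^sub>C A i) = 0" if j: "j \<in> I" for j
  proof (rule bop_eqI)
    fix z :: 'h
    let ?e = "\<lambda>l. if l = j then z else 0"
    have entry: "(\<Sum>l\<in>I. bop_apply (P i l) (?e l)) = c i j *\<^sub>C z" if "i \<in> I" for i
    proof -
      have "(\<Sum>l\<in>I. bop_apply (P i l) (?e l)) = (\<Sum>l\<in>I. if l = j then bop_apply (P i j) z else 0)"
        by (intro sum.cong) auto
      then show ?thesis
        using I j that by (simp add: c)
    qed
    have "(\<Sum>i\<in>I. bop_apply (A i) (bop_apply 1 (\<Sum>l\<in>I. bop_apply (P i l) (?e l)))) = 0"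
      using P_K[of ?e] one_in_commutant unfolding K_def by blast
    then show "bop_apply (\<Sum>i\<in>I. c i j *\<^sub>C A i) z = bop_apply 0 z"
      by (simp add: bop_apply_sum entry bop_apply_scaleC cong: sum.cong)
  qed
  have \<phi>_B: "\<phi> (B i) = (\<Sum>j\<in>I. c i j *\<^sub>C \<phi> (B j))" if "i \<in> I" for i
    using trans[OF arg_cong[OF B_relation[OF that], of \<phi>]
        conjunct2[OF linear_self_map_sum[OF \<phi> star I B]]] .
  have "(\<Sum>i\<in>I. A i * \<phi> (B i)) = (\<Sum>i\<in>I. A i * (\<Sum>j\<in>I. c i j *\<^sub>C \<phi> (B j)))"
    by (intro sum.cong arg_cong2[where f = times] refl \<phi>_B)
  also have "\<dots> = (\<Sum>j\<in>I. (\<Sum>i\<in>I. c i j *\<^sub>C A i) * \<phi> (B j))"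
    unfolding sum_distrib_left sum_distrib_right times_scaleC_right by (rule sum.swap)
  also have "\<dots> = 0"
    by (simp add: A_relation)
  finally show ?thesis .
qed

text \<open>
  The definite description in the definition of the extended map denotes a value only if any other
  representation of \<open>A B\<close> gives the same result, which is the preceding lemma applied to the
  difference of the two representations.
\<close>
lemma tilde_map_product:
  assumes M: "von_neumann_factor M" and \<phi>: "linear_self_map M \<phi>"
    and A: "A \<in> commutant M" and B: "B \<in> M"
  shows "tilde_map M \<phi> (A * B) = A * \<phi> B"
  unfolding tilde_map_def
proof (rule the_equality)
  show "\<exists>(n::nat) A' B'. (\<forall>i<n. A' i \<in> commutant M \<and> B' i \<in> M) \<and>
      A * B = (\<Sum>i<n. A' i * B' i) \<and> A * \<phi> B = (\<Sum>i<n. A' i * \<phi> (B' i))"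
    by (rule exI[of _ 1], rule exI[of _ "\<lambda>_. A"], rule exI[of _ "\<lambda>_. B"]) (simp add: A B)
next
  fix S
  assume "\<exists>(n::nat) A' B'. (\<forall>i<n. A' i \<in> commutant M \<and> B' i \<in> M) \<and>
      A * B = (\<Sum>i<n. A' i * B' i) \<and> S = (\<Sum>i<n. A' i * \<phi> (B' i))"
  then obtain n :: nat and A' B' where
    mem: "\<And>i. i < n \<Longrightarrow> A' i \<in> commutant M" "\<And>i. i < n \<Longrightarrow> B' i \<in> M"
    and rep: "A * B = (\<Sum>i<n. A' i * B' i)" "S = (\<Sum>i<n. A' i * \<phi> (B' i))"
    by blast
  have star: "star_subalgebra (commutant M)"
    using M by (intro star_subalgebra_commutant)
      (simp add: von_neumann_factor_def von_neumann_algebra_def star_subalgebra_def)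
  have "- A \<in> commutant M"
    using star A by (metis scaleC_minus1 star_subalgebra_def)
  \<comment> \<open>The new term \<open>- A B\<close>, put at index \<open>n\<close>, turns the second representation into a zero sum.\<close>
  then have "(\<Sum>i\<in>{..<Suc n}. (A'(n := - A)) i * \<phi> ((B'(n := B)) i)) = 0"
    using mem B rep(1) by (intro factor_sum_products_zero[OF M \<phi>]) (auto simp: less_Suc_eq)
  then show "S = A * \<phi> B"
    by (simp add: rep(2))
qed

section \<open>Positive operators\<close>

text \<open>
  Reality of \<open>(Tx|x)\<close> for all \<open>x\<close> gives symmetry of \<open>T\<close> by polarisation over the complex field.
\<close>
lemma positive_op_iff:
  "positive_op T \<longleftrightarrow> (\<forall>x y. inner (bop_apply T x) y = inner x (bop_apply T y)) \<and>
    (\<forall>x. 0 \<le> inner (bop_apply T x) x)"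
proof -
  have ii: "\<i> *\<^sub>C \<i> *\<^sub>C x = - x" for x :: 'a
    by (simp add: scaleC_scaleC scaleC_minus1)
  have skew: "inner (\<i> *\<^sub>C x) y = - inner x (\<i> *\<^sub>C y)" for x y :: 'a
    by (simp add: inner_scaleC_left scaleC_minus_left)
  have "(\<forall>x. inner (bop_apply T x) (\<i> *\<^sub>C x) = 0) \<longleftrightarrow>
      (\<forall>x y. inner (bop_apply T x) y = inner x (bop_apply T y))" (is "?real \<longleftrightarrow> ?sym")
  proof
    assume real: ?real
    show ?sym
    proof (intro allI)
      fix x y
      have "inner (bop_apply T (x + \<i> *\<^sub>C y)) (\<i> *\<^sub>C (x + \<i> *\<^sub>C y)) = 0"
        using real by blast
      then have "inner (bop_apply T x) (- y) + inner (\<i> *\<^sub>C bop_apply T y) (\<i> *\<^sub>C x) = 0"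
        using real[rule_format, of x] real[rule_format, of "\<i> *\<^sub>C y"]
        by (simp add: bop_apply_add bop_apply_scaleC scaleC_add_right inner_add_left
            inner_add_right inner_diff_right ii)
      then show "inner (bop_apply T x) y = inner x (bop_apply T y)"
        by (simp add: skew ii inner_commute)
    qed
  next
    assume sym: ?sym
    show ?real
    proof
      fix x
      have "inner (bop_apply T x) (\<i> *\<^sub>C x) = inner x (\<i> *\<^sub>C bop_apply T x)"
        using sym by (simp add: bop_apply_scaleC)
      then show "inner (bop_apply T x) (\<i> *\<^sub>C x) = 0"
        using skew[of x "bop_apply T x"] by (simp add: inner_commute)
    qed
  qed
  then show ?thesis
    by (auto simp: positive_op_def cinner_eq_inner less_eq_complex_def)
qed

text \<open>
  Riesz's iteration replaces the square root of \<open>S\<close>: after scaling to \<open>0 \<le> S \<le> 1\<close>, the operators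
  \<open>R\<^sub>0 = S\<close>, \<open>R\<^sub>n\<^sub>+\<^sub>1 = R\<^sub>n - R\<^sub>n\<^sup>2\<close> stay between 0 and 1 and commute with \<open>T\<close>, and
  \<open>S = \<Sum>k<n. R\<^sub>k\<^sup>2 + R\<^sub>n\<close> with \<open>R\<^sub>n \<rightarrow> 0\<close> strongly; thus \<open>(STx|x)\<close> is the sum of the numbers
  \<open>(T R\<^sub>k x|R\<^sub>k x) \<ge> 0\<close>.
\<close>
lemma positive_op_mult_commuting:
  fixes S T :: "'h::complex_hilbert bop"
  assumes S: "positive_op S" and T: "positive_op T" and ST: "S * T = T * S"
  shows "positive_op (S * T)"
proof -
  obtain b where b: "b > 0" "\<And>x. norm (bop_apply S x) \<le> norm x * b"
    using bounded_linear.pos_bounded[OF bounded_linear_bop_apply] by blast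
  define R where "R n = ((\<lambda>U. U - U * U) ^^ n) ((1 / b) *\<^sub>R S)" for n
  have R_0: "R 0 = (1 / b) *\<^sub>R S" and R_Suc: "R (Suc n) = R n - R n * R n" for n
    by (simp_all add: R_def)
  have R_0_apply: "bop_apply (R 0) x = (1 / b) *\<^sub>R bop_apply S x" for x
    unfolding R_0 by (simp add: scaleR_scaleC)
  have T_sym: "inner (bop_apply T x) y = inner x (bop_apply T y)"
    and T_pos: "0 \<le> inner (bop_apply T x) x" for x y
    using T by (auto simp: positive_op_iff)
  have S_sym: "inner (bop_apply S x) y = inner x (bop_apply S y)"
    and S_pos: "0 \<le> inner (bop_apply S x) x" for x y
    using S by (auto simp: positive_op_iff)
  have R: "(\<forall>x y. inner (bop_apply (R n) x) y = inner x (bop_apply (R n) y)) \<and>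
      (\<forall>x. 0 \<le> inner (bop_apply (R n) x) x) \<and> (\<forall>x. inner (bop_apply (R n) x) x \<le> inner x x) \<and>
      R n * T = T * R n" for n
  proof (induction n)
    case 0
    have "inner (bop_apply S x) x \<le> b * inner x x" for x
    proof -
      have "inner (bop_apply S x) x \<le> norm (bop_apply S x) * norm x"
        by (rule norm_cauchy_schwarz)
      also have "\<dots> \<le> norm x * b * norm x"
        by (intro mult_right_mono b) simp
      finally show ?thesis
        by (simp add: mult_ac dot_square_norm power2_eq_square)
    qed
    moreover have "R 0 * T = T * R 0"
      using ST by (simp add: R_0 scaleR_scaleC bop_apply_inject[symmetric] fun_eq_iff bop_apply_scaleC)
    ultimately show ?case
      using b(1) S_pos by (auto simp: R_0_apply S_sym divide_simps mult_ac)
  next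
    case (Suc n)
    let ?r = "bop_apply (R n)"
    have sym: "inner (?r x) y = inner x (?r y)" and pos: "0 \<le> inner (?r x) x"
      and le: "inner (?r x) x \<le> inner x x" and comm: "R n * T = T * R n" for x y
      using Suc by auto
    have "0 \<le> inner (bop_apply (R (Suc n)) x) x" for x
    proof -
      \<comment> \<open>\<open>R - R\<^sup>2 = R (1 - R) R + (1 - R) R (1 - R)\<close>\<close>
      have "inner (bop_apply (R (Suc n)) x) x
          = (inner (?r x) (?r x) - inner (?r (?r x)) (?r x))
            + inner (?r (x - ?r x)) (x - ?r x)"
        by (simp add: R_Suc bop_apply_diff inner_diff_left inner_diff_right sym)
      then show ?thesis
        using le[of "?r x"] pos[of "x - ?r x"] by simp
    qed
    moreover have "inner (bop_apply (R (Suc n)) x) x \<le> inner x x" for x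
      using le[of x] inner_ge_zero[of "?r x"] by (simp add: R_Suc inner_diff_left sym)
    moreover have "R (Suc n) * T = T * R (Suc n)"
      by (simp add: R_Suc left_diff_distrib right_diff_distrib comm)
        (metis comm mult.assoc)
    ultimately show ?case
      by (simp add: R_Suc inner_diff_left inner_diff_right sym)
  qed
  have R_sym: "inner (bop_apply (R n) x) y = inner x (bop_apply (R n) y)"
    and R_pos: "0 \<le> inner (bop_apply (R n) x) x"
    for n x y
    using R[of n] by auto
  have R_T: "bop_apply (R n) (bop_apply T x) = bop_apply T (bop_apply (R n) x)" for n x
    using R[of n] by (metis times_bop.rep_eq)
  have telescope: "bop_apply (R 0) x
      = (\<Sum>k<n. bop_apply (R k) (bop_apply (R k) x)) + bop_apply (R n) x" for n x
    by (induction n) (simp_all add: R_Suc)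
  have R_tendsto_0: "(\<lambda>n. bop_apply (R n) x) \<longlonglongrightarrow> 0" for x
  proof -
    have "(\<Sum>k<n. (norm (bop_apply (R k) x))\<^sup>2) \<le> inner (bop_apply (R 0) x) x" for n
      using R_pos[of n x]
      by (subst telescope[of x n]) (simp add: inner_add_left inner_sum_left R_sym power2_norm_eq_inner)
    then have "summable (\<lambda>k. (norm (bop_apply (R k) x))\<^sup>2)"
      by (intro summableI_nonneg_bounded) auto
    then have "(\<lambda>k. sqrt ((norm (bop_apply (R k) x))\<^sup>2)) \<longlonglongrightarrow> sqrt 0"
      by (intro tendsto_real_sqrt summable_LIMSEQ_zero)
    then show ?thesis
      by (simp add: tendsto_norm_zero_iff)
  qed
  have "0 \<le> inner (bop_apply S (bop_apply T x)) x" for x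
  proof -
    have "inner (bop_apply T x) (bop_apply (R n) x) \<le> inner (bop_apply (R 0) (bop_apply T x)) x" for n
    proof -
      have "0 \<le> (\<Sum>k<n. inner (bop_apply T (bop_apply (R k) x)) (bop_apply (R k) x))"
        by (intro sum_nonneg T_pos)
      then show ?thesis
        by (subst telescope[of _ n]) (simp add: inner_add_left inner_sum_left R_sym flip: R_T)
    qed
    moreover have "(\<lambda>n. inner (bop_apply T x) (bop_apply (R n) x)) \<longlonglongrightarrow> inner (bop_apply T x) 0"
      by (intro tendsto_intros R_tendsto_0)
    ultimately have "0 \<le> inner (bop_apply (R 0) (bop_apply T x)) x"
      using LIMSEQ_le_const2 by fastforce
    then show ?thesis
      using b(1) by (simp add: R_0_apply zero_le_divide_iff)
  qed
  moreover have "inner (bop_apply (S * T) x) y = inner x (bop_apply (S * T) y)" for x y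
    by (subst (2) ST) (simp add: S_sym T_sym)
  ultimately show ?thesis
    by (simp add: positive_op_iff)
qed

section \<open>Positive maps on a factor\<close>

theorem theorem3p5:
  fixes M :: "'h::complex_hilbert bop set"
    and x0 :: 'h
    and \<phi> :: "'h bop \<Rightarrow> 'h bop"
  assumes "separable_space (euclidean :: 'h topology)"
    and "von_neumann_factor M"
    and "norm x0 = 1"
    and "separating_vector M x0"
    and "cyclic_vector M x0"
    and "linear_self_map M \<phi>"
  shows "positive_map M \<phi> \<longleftrightarrow>
    (\<forall>A'\<in>commutant M. \<forall>B\<in>M. positive_op A' \<longrightarrow> positive_op B \<longrightarrow>
      0 \<le> (vec_functional x0 x0 \<circ> tilde_map M \<phi>) (A' * B))"
proof -
  have \<phi>_mem: "\<phi> B \<in> M" if "B \<in> M" for B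
    using assms(6) that by (auto simp: linear_self_map_def)
  have functional: "(vec_functional x0 x0 \<circ> tilde_map M \<phi>) (A * B)
      = cinner (bop_apply (A * \<phi> B) x0) x0" if "A \<in> commutant M" "B \<in> M" for A B
    using tilde_map_product[OF assms(2,6) that] by (simp add: vec_functional_def)
  have vN: "von_neumann_algebra M"
    using assms(2) by (simp add: von_neumann_factor_def)
  then have star': "star_subalgebra (commutant M)"
    by (intro star_subalgebra_commutant) (simp add: von_neumann_algebra_def star_subalgebra_def)
  show ?thesis
  proof
    assume pos: "positive_map M \<phi>"
    show "\<forall>A'\<in>commutant M. \<forall>B\<in>M. positive_op A' \<longrightarrow> positive_op B \<longrightarrow>
      0 \<le> (vec_functional x0 x0 \<circ> tilde_map M \<phi>) (A' * B)"
    proof (intro ballI impI)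
      fix A B assume A: "A \<in> commutant M" "positive_op A" and B: "B \<in> M" "positive_op B"
      have "positive_op (A * \<phi> B)"
        using pos A B commutantD[OF A(1) \<phi>_mem[OF B(1)]]
        by (intro positive_op_mult_commuting) (auto simp: positive_map_def)
      then show "0 \<le> (vec_functional x0 x0 \<circ> tilde_map M \<phi>) (A * B)"
        unfolding functional[OF A(1) B(1)] by (simp add: positive_op_def)
    qed
  next
    assume nonneg: "\<forall>A'\<in>commutant M. \<forall>B\<in>M. positive_op A' \<longrightarrow> positive_op B \<longrightarrow>
      0 \<le> (vec_functional x0 x0 \<circ> tilde_map M \<phi>) (A' * B)"
    show "positive_map M \<phi>"
      unfolding positive_map_def
    proof (intro ballI impI)
      fix B assume B: "B \<in> M" "positive_op B"
      have dense_nonneg: "0 \<le> cinner (bop_apply (\<phi> B) (bop_apply T x0)) (bop_apply T x0)"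
        if T: "T \<in> commutant M" for T
      proof -
        have T': "adj T * T \<in> commutant M" "adj T \<in> commutant M"
          using star' T by (auto simp: star_subalgebra_def)
        have "cinner (bop_apply (adj T * T) x) x = cinner (bop_apply T x) (bop_apply T x)" for x
          by (simp add: adj_cinner adj_adj)
        then have "positive_op (adj T * T)"
          by (simp add: positive_op_def cinner_self less_eq_complex_def)
        then have "0 \<le> cinner (bop_apply (adj T * T * \<phi> B) x0) x0"
          using nonneg T' B functional by metis
        also have "bop_apply (adj T * T * \<phi> B) x0
            = bop_apply (adj T) (bop_apply (\<phi> B) (bop_apply T x0))"
          by (simp add: commutant_apply_commute[OF T \<phi>_mem[OF B(1)]])
        finally show ?thesis
          by (simp add: adj_cinner adj_adj)
      qed
      show "positive_op (\<phi> B)"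
        unfolding positive_op_def
      proof
        fix x
        have "x \<in> closure ((\<lambda>T. bop_apply T x0) ` commutant M)"
          using separating_imp_cyclic_commutant[OF vN assms(4)] by (simp add: cyclic_vector_def)
        then obtain y where y: "\<And>n. y n \<in> (\<lambda>T. bop_apply T x0) ` commutant M" "y \<longlonglongrightarrow> x"
          unfolding closure_sequential by blast
        have lim: "(\<lambda>n. cinner (bop_apply (\<phi> B) (y n)) (y n)) \<longlonglongrightarrow> cinner (bop_apply (\<phi> B) x) x"
          by (rule tendsto_cinner[OF tendsto_bop_apply[OF y(2)] y(2)])
        have nonneg_y: "0 \<le> cinner (bop_apply (\<phi> B) (y n)) (y n)" for n
          using y(1)[of n] dense_nonneg by auto
        then have "0 \<le> Re (cinner (bop_apply (\<phi> B) x) x)"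
          by (intro LIMSEQ_le_const[OF tendsto_Re[OF lim]]) (auto simp: less_eq_complex_def)
        moreover have "Im (cinner (bop_apply (\<phi> B) x) x) = 0"
          using tendsto_Im[OF lim] nonneg_y by (simp add: less_eq_complex_def LIMSEQ_const_iff)
        ultimately show "0 \<le> cinner (bop_apply (\<phi> B) x) x"
          by (simp add: less_eq_complex_def)
      qed
    qed
  qed
qed

end
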